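(* Let $(\lambda_n)_{n\in\mathbb{N}}$ and $(\mu_n)_{n\in\mathbb{N}}$ be sequences in $\Lambda$, let $d\in\mathbb{N}$, let $D\subseteq\mathbb{R}^d$ be a nonempty convex set, and let $f:D\to\mathbb{R}$ be bounded from below. If the inequality $$f\left(\sum_{i=1}^\infty \lambda_i x_i\right)\leq \sum_{i=1}^\infty \mu_i f(x_i)$$ holds for all bounded sequences $(x_i)_{i\in\mathbb{N}}$ with $x_i\in D$, $i\in\mathbb{N}$, then $f$ is convex. Here the right-hand side of the inequality is either convergent, or else it diverges to the extended real number $+\infty$.
   Context: $\mathbb{N}$ denotes the set of positive integers. The set $\Lambda$ is defined by $$\Lambda:=\left\{(\lambda_n)_{n\in\mathbb{N}} : \lambda_n\geq\lambda_{n+1}>0 \text{ for all } n\in\mathbb{N},\ \text{and}\ \sum_{n=1}^\infty\lambda_n=1\right\}$$ (real sequences). A function $f:D\to\mathbb{R}$ on a nonempty convex set $D\subseteq\mathbb{R}^d$ is called convex if $f(tx+(1-t)y)\leq tf(x)+(1-t)f(y)$ for all $x,y\in D$ and all $t\in(0,1)$. The set $D$ is not assumed to be open, closed or bounded. For every bounded sequence $(x_i)_{i\in\mathbb{N}}$ in $D$, the series $\sum_{i=1}^\infty\lambda_i x_i$ converges absolutely and its sum belongs to $D$, so the left-hand side of the inequality is well-defined. When the right-hand side is $+\infty$, the inequality is understood in the extended real numbers (and holds trivially). *)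

theory Defs
  imports "HOL-Analysis.Analysis"
begin

(* Sequences are indexed from 0: "l i" stands for \<lambda>_{i+1}. *)
definition Lambda :: "(nat \<Rightarrow> real) set" where
  "Lambda = {l. (\<forall>n. l (Suc n) \<le> l n \<and> l (Suc n) > 0) \<and> l sums 1}"

(* suminf is arbitrary on divergent series; this lemma shows that the series of extended
   reals used for the right-hand side of the inequality always has a sum, real or +\<infinity>. *)
lemma weighted_series_ereal:
  fixes f :: "'a \<Rightarrow> real" and x :: "nat \<Rightarrow> 'a"
  assumes m: "m \<in> Lambda" and b: "bdd_below (f ` D)" and x: "\<And>i. x i \<in> D"
  shows "summable (\<lambda>i. ereal (m i * f (x i)))"
    and "(\<Sum>i. ereal (m i * f (x i))) \<noteq> -\<infinity>"
proof -
  obtain c where c: "\<And>y. y \<in> D \<Longrightarrow> c \<le> f y"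
    using b by (auto simp: bdd_below_def)
  have pos: "m i > 0" for i
    using m less_le_trans[of 0 "m (Suc 0)" "m 0"] by (cases i) (auto simp: Lambda_def)
  have m1: "m sums 1"
    using m by (simp add: Lambda_def)
  define g where "g i = m i * (f (x i) - c)" for i
  have g0: "g i \<ge> 0" for i
    using pos[of i] c[OF x[of i]] by (simp add: g_def)
  define L where "L = (\<Sum>i. ereal (g i))"
  have summ: "summable (\<lambda>i. ereal (g i))"
    by (rule summable_ereal_pos) (simp add: g0)
  have L: "(\<lambda>n. \<Sum>i<n. ereal (g i)) \<longlonglongrightarrow> L"
    using summable_sums[OF summ] unfolding L_def sums_def .
  have L0: "L \<ge> 0"
    unfolding L_def by (rule suminf_nonneg[OF summ]) (simp add: g0)
  have C: "(\<lambda>n. \<Sum>i<n. ereal (m i * c)) \<longlonglongrightarrow> ereal c"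
    using sums_mult2[OF m1, of c] by (simp add: sums_ereal flip: sums_def)
  have "(\<lambda>n. (\<Sum>i<n. ereal (g i)) + (\<Sum>i<n. ereal (m i * c))) \<longlonglongrightarrow> L + ereal c"
    using L0 by (intro tendsto_add_ereal_general[OF _ L C]) auto
  moreover have "(\<Sum>i<n. ereal (g i)) + (\<Sum>i<n. ereal (m i * c)) =
      (\<Sum>i<n. ereal (m i * f (x i)))" for n
    by (simp add: g_def algebra_simps flip: sum.distrib)
  ultimately have *: "(\<lambda>i. ereal (m i * f (x i))) sums (L + ereal c)"
    by (simp add: sums_def)
  show "summable (\<lambda>i. ereal (m i * f (x i)))"
    using * by (rule sums_summable)
  show "(\<Sum>i. ereal (m i * f (x i))) \<noteq> -\<infinity>"
    unfolding sums_unique[OF *, symmetric] using L0 by (cases L) auto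
qed

end

theory Submission
  imports Defs
begin

text \<open>Restrict to a segment, i.e. to \<open>g\<close> on \<open>[0,1]\<close>. The inequality for sequences specialises to
  \<open>g (p * x + (1 - p) * y) \<le> q * g x + (1 - q) * g y\<close> for fixed \<open>p, q\<close> in \<open>(0,1)\<close>. Hence the set
  where \<open>g \<le> max (g 0) (g 1)\<close> is dense in \<open>[0,1]\<close>; every point of \<open>[0,1]\<close> is an infinite
  \<open>\<lambda>\<close>-combination of points of a dense set containing 0 and 1, so the bound holds everywhere.
  Finally, write \<open>t = p * x + (1 - p) * y\<close> with \<open>x\<close> or \<open>y\<close> an endpoint of \<open>[0,1]\<close>. If the endpoint is
  chosen according to the signs of \<open>p - q\<close> and \<open>g 1 - g 0\<close>, the supremum \<open>C\<close> of the excess of \<open>g\<close>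
  over its chord satisfies \<open>C \<le> max q (1 - q) * C\<close>, and so \<open>C \<le> 0\<close>.\<close>

lemma Lambda_pos: "l \<in> Lambda \<Longrightarrow> l i > 0"
  using less_le_trans[of 0 "l (Suc 0)" "l 0"] by (cases i) (auto simp: Lambda_def)

lemma Lambda_sums: "l \<in> Lambda \<Longrightarrow> l sums 1"
  by (simp add: Lambda_def)

section \<open>Dense sets and infinite combinations\<close>

text \<open>Bracket the midpoint of \<open>a\<close> and \<open>b\<close> between two points
  \<open>u\<close>, \<open>v\<close> of \<open>A\<close>, starting with 0 and 1. Replacing one of
  them by \<open>p * u + (1 - p) * v\<close> keeps a bracket and shrinks it by a factor of at most
  \<open>max p (1 - p)\<close>. Once it is shorter than \<open>(b - a) / 2\<close>, the point
  \<open>u\<close> lies between \<open>a\<close> and \<open>b\<close>.\<close>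

lemma dense_if_closed_under_fixed_combination:
  fixes A :: "real set" and p :: real
  assumes "0 \<in> A" "1 \<in> A" and p: "0 < p" "p < 1"
    and comb: "\<And>x y. x \<in> A \<Longrightarrow> y \<in> A \<Longrightarrow> p * x + (1 - p) * y \<in> A"
    and ab: "0 \<le> a" "a < b" "b \<le> 1"
  obtains x where "x \<in> A" "a \<le> x" "x \<le> b"
proof -
  define q where "q = max p (1 - p)"
  define t where "t = (a + b) / 2"
  have q: "0 < q" "q < 1" "p \<le> q" "1 - p \<le> q"
    using p by (auto simp: q_def)
  have "\<exists>u\<in>A. \<exists>v\<in>A. u \<le> t \<and> t \<le> v \<and> v - u \<le> q ^ n" for n
  proof (induction n)
    case 0
    then show ?case
      using assms by (intro bexI[of _ 0] bexI[of _ 1]) (auto simp: t_def)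
  next
    case (Suc n)
    then obtain u v where uv: "u \<in> A" "v \<in> A" "u \<le> t" "t \<le> v" "v - u \<le> q ^ n"
      by blast
    define m where "m = p * u + (1 - p) * v"
    have m: "m \<in> A"
      unfolding m_def by (intro comb uv)
    have "v - m = p * (v - u)" "m - u = (1 - p) * (v - u)"
      by (simp_all add: m_def algebra_simps)
    moreover have "p * (v - u) \<le> q * q ^ n" "(1 - p) * (v - u) \<le> q * q ^ n"
      using uv q p by (intro mult_mono; simp)+
    ultimately have "m - u \<le> q ^ Suc n" "v - m \<le> q ^ Suc n"
      by simp_all
    then show ?case
      using uv m by (cases "t \<le> m") (meson linear)+
  qed
  moreover obtain n where "q ^ n < (b - a) / 2"
    using real_arch_pow_inv[of "(b - a) / 2" q] q ab by auto
  ultimately obtain u v where "u \<in> A" "u \<le> t" "t \<le> v" "v - u < (b - a) / 2"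
    by (meson le_less_trans)
  then show ?thesis
    using that[of u] ab by (simp add: t_def field_simps)
qed

text \<open>Greedy choice of the coefficients: the remainder after \<open>k\<close> steps is kept between 0 and the
  tail \<open>r k\<close>. The next coefficient may then be taken from a nondegenerate interval (or is an
  endpoint 0 or 1), so it can be found in the dense set.\<close>

lemma sums_with_coefficients_in_dense_set:
  fixes l :: "nat \<Rightarrow> real" and A :: "real set"
  assumes l: "\<And>i. l i > 0" "l sums 1" and A: "0 \<in> A" "1 \<in> A"
    and dense: "\<And>a b. 0 \<le> a \<Longrightarrow> a < b \<Longrightarrow> b \<le> 1 \<Longrightarrow> \<exists>x\<in>A. a \<le> x \<and> x \<le> b"
    and t: "0 \<le> t" "t \<le> 1"
  obtains x where "\<And>i. x i \<in> A" "(\<lambda>i. l i * x i) sums t"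
proof -
  define r where "r n = 1 - (\<Sum>i<n. l i)" for n
  have r_Suc: "r n = l n + r (Suc n)" for n
    by (simp add: r_def)
  have r_pos: "r n > 0" for n
    using sum_less_suminf[of l n] l sums_unique[OF l(2)] sums_summable[OF l(2)] by (auto simp: r_def)
  have r_lim: "r \<longlonglongrightarrow> 0"
    using tendsto_diff[OF tendsto_const[of 1] l(2)[unfolded sums_def]] by (simp add: r_def[abs_def])
  have "\<exists>x\<in>A. 0 \<le> s - l n * x \<and> s - l n * x \<le> r (Suc n)" if s: "0 \<le> s" "s \<le> r n" for s n
  proof -
    \<comment> \<open>In the first two cases the only admissible \<open>x\<close> in
      \<open>[0,1]\<close> is 0 or 1, respectively. In the third the admissible \<open>x\<close>
      form an interval of positive length, because \<open>r n = l n + r (Suc n)\<close>.\<close>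
    consider "s = 0" | "s = r n" | "0 < s" "s < r n"
      using s by linarith
    then show ?thesis
    proof cases
      case 1
      then show ?thesis using A r_pos[of "Suc n"] by (intro bexI[of _ 0]) auto
    next
      case 2
      then show ?thesis using A r_Suc[of n] r_pos[of "Suc n"] by (intro bexI[of _ 1]) auto
    next
      case 3
      have "\<exists>x\<in>A. max 0 ((s - r (Suc n)) / l n) \<le> x \<and> x \<le> min 1 (s / l n)"
        using 3 l(1)[of n] r_Suc[of n] r_pos[of "Suc n"]
        by (intro dense) (auto simp: field_simps)
      then show ?thesis
        using l(1)[of n] by (auto simp: field_simps)
    qed
  qed
  then obtain c where c: "\<And>s n. 0 \<le> s \<Longrightarrow> s \<le> r n \<Longrightarrow>
      c s n \<in> A \<and> 0 \<le> s - l n * c s n \<and> s - l n * c s n \<le> r (Suc n)"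
    by metis
  define s where "s = rec_nat t (\<lambda>n s. s - l n * c s n)"
  have s_Suc: "s (Suc n) = s n - l n * c (s n) n" for n
    by (simp add: s_def)
  have s: "0 \<le> s n \<and> s n \<le> r n" for n
  proof (induction n)
    case 0
    then show ?case using t by (simp add: s_def r_def)
  next
    case (Suc n)
    then show ?case using c[of "s n" n] by (simp add: s_Suc)
  qed
  have "(\<Sum>i<n. l i * c (s i) i) = t - s n" for n
    by (induction n) (simp_all add: s_Suc, simp add: s_def)
  moreover have "s \<longlonglongrightarrow> 0"
    by (rule tendsto_sandwich[OF _ _ tendsto_const r_lim]) (use s in auto)
  then have "(\<lambda>n. t - s n) \<longlonglongrightarrow> t"
    using tendsto_diff[OF tendsto_const[of t], of s 0 sequentially] by simp
  ultimately have "(\<lambda>i. l i * c (s i) i) sums t"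
    by (simp add: sums_def)
  moreover have "c (s i) i \<in> A" for i
    using c s by blast
  ultimately show ?thesis
    using that[of "\<lambda>i. c (s i) i"] by blast
qed

section \<open>From sequences to two points\<close>

lemma summable_mult_bounded:
  fixes m u :: "nat \<Rightarrow> real"
  assumes "\<And>i. m i > 0" "summable m" "\<And>i. \<bar>u i\<bar> \<le> K"
  shows "summable (\<lambda>i. m i * u i)"
proof (rule summable_comparison_test'[of "\<lambda>i. m i * K" 0])
  show "summable (\<lambda>i. m i * K)"
    using assms by (intro summable_mult2)
  show "norm (m n * u n) \<le> m n * K" for n
    using assms(1)[of n] assms(3)[of n] by (simp add: abs_mult)
qed

text \<open>Giving all entries from the third one on the value \<open>p * x + (1 - p) * y\<close> turns the inequality
  for sequences into one for two points.\<close>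

lemma two_point_inequality:
  fixes l m :: "nat \<Rightarrow> real" and g :: "real \<Rightarrow> real"
  defines "p \<equiv> l 0 / (l 0 + l 1)" and "q \<equiv> m 0 / (m 0 + m 1)"
  assumes l: "\<And>i. l i > 0" "l sums 1" and m: "\<And>i. m i > 0" "m sums 1"
    and ineq: "\<And>x K. (\<And>i. x i \<in> {0..1}) \<Longrightarrow> (\<And>i. g (x i) \<le> K) \<Longrightarrow>
      g (\<Sum>i. l i * x i) \<le> (\<Sum>i. m i * g (x i))"
    and xy: "x \<in> {0..1}" "y \<in> {0..1}"
  shows "g (p * x + (1 - p) * y) \<le> q * g x + (1 - q) * g y"
proof -
  define z where "z = p * x + (1 - p) * y"
  define w where "w i = (if i = 0 then x else if i = 1 then y else z)" for i :: nat
  have p: "0 < p" "p < 1"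
    using l(1)[of 0] l(1)[of 1] by (auto simp: p_def field_simps)
  have "z \<in> {0..1}"
    using convexD[of "{0..1::real}" x y p "1 - p"] xy p by (auto simp: z_def)
  then have w: "w i \<in> {0..1}" for i
    using xy by (simp add: w_def)
  have sums_w: "(\<lambda>i. a i * F (w i)) sums (F z + a 0 * (F x - F z) + a 1 * (F y - F z))"
    if "a sums 1" for a :: "nat \<Rightarrow> real" and F :: "real \<Rightarrow> real"
  proof -
    have "(\<lambda>i. a i * F z + (if i = 0 then a i * (F x - F z) else 0)
        + (if i = 1 then a i * (F y - F z) else 0))
        sums (1 * F z + a 0 * (F x - F z) + a 1 * (F y - F z))"
      using that by (intro sums_add sums_mult2 sums_single)
    moreover have "(\<lambda>i. a i * F z + (if i = 0 then a i * (F x - F z) else 0)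
        + (if i = 1 then a i * (F y - F z) else 0)) = (\<lambda>i. a i * F (w i))"
      by (auto simp: w_def fun_eq_iff algebra_simps)
    ultimately show ?thesis by simp
  qed
  \<comment> \<open>By this identity the deviations of the first two terms from \<open>z\<close>
    cancel in the \<open>l\<close>-series, so its sum is \<open>z\<close> again and
    \<open>g z\<close> occurs on both sides of the inequality.\<close>
  have lz: "(l 0 + l 1) * z = l 0 * x + l 1 * y"
  proof -
    have "(l 0 + l 1) * p = l 0" "(l 0 + l 1) * (1 - p) = l 1"
      using l(1)[of 0] l(1)[of 1] by (auto simp: p_def field_simps)
    then show ?thesis
      unfolding z_def by (metis distrib_left mult.assoc)
  qed
  have "g (\<Sum>i. l i * w i) \<le> (\<Sum>i. m i * g (w i))"
    by (rule ineq[where K = "max (g x) (max (g y) (g z))"]) (use w in \<open>auto simp: w_def\<close>)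
  also have "(\<Sum>i. l i * w i) = z"
    using sums_unique[OF sums_w[OF l(2), of "\<lambda>u. u"]] lz by (simp add: algebra_simps)
  also have "(\<Sum>i. m i * g (w i)) = g z + m 0 * (g x - g z) + m 1 * (g y - g z)"
    using sums_unique[OF sums_w[OF m(2), of g]] by simp
  finally have "(m 0 + m 1) * g z \<le> m 0 * g x + m 1 * g y"
    by (simp add: algebra_simps)
  moreover have "1 - q = m 1 / (m 0 + m 1)"
    using m(1)[of 0] m(1)[of 1] by (simp add: q_def field_simps)
  then have "q * g x + (1 - q) * g y = (m 0 * g x + m 1 * g y) / (m 0 + m 1)"
    by (simp add: q_def add_divide_distrib)
  moreover have "g z \<le> X / (m 0 + m 1)" if "(m 0 + m 1) * g z \<le> X" for X
    using that m(1)[of 0] m(1)[of 1] by (simp add: pos_le_divide_eq mult.commute)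
  ultimately show ?thesis
    by (simp add: z_def)
qed

section \<open>Comparison with the chord\<close>

text \<open>The excess over the chord vanishes at 0 and 1. Take \<open>y = 0\<close> if
  \<open>t \<le> p\<close>, and \<open>x = 1\<close> otherwise: then only the other point
  contributes excess, with weight \<open>q\<close> or \<open>1 - q\<close>. The linear parts compare
  in the right direction since \<open>q \<le> p\<close> and \<open>g 0 \<le> g 1\<close>.\<close>

lemma chord_excess_contraction:
  fixes g :: "real \<Rightarrow> real"
  assumes pq: "0 < p" "p < 1" "0 < q" "q \<le> p"
    and two: "\<And>x y. x \<in> {0..1} \<Longrightarrow> y \<in> {0..1} \<Longrightarrow>
      g (p * x + (1 - p) * y) \<le> q * g x + (1 - q) * g y"
    and mono: "g 0 \<le> g 1"
    and C: "0 \<le> C" "\<And>t. t \<in> {0..1} \<Longrightarrow> g t - ((1 - t) * g 0 + t * g 1) \<le> C"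
    and t: "t \<in> {0..1}"
  shows "g t - ((1 - t) * g 0 + t * g 1) \<le> max q (1 - q) * C"
proof -
  define d where "d = g 1 - g 0"
  have d: "0 \<le> d" "g 1 = g 0 + d"
    using mono by (auto simp: d_def)
  have chord: "(1 - s) * g 0 + s * g 1 = g 0 + s * d" for s
    by (simp add: d algebra_simps)
  have C': "g s \<le> C + g 0 + s * d" if "s \<in> {0..1}" for s
    using C(2)[OF that] unfolding chord by simp
  have "q * C \<le> max q (1 - q) * C" "(1 - q) * C \<le> max q (1 - q) * C"
    using C(1) by (auto intro: mult_right_mono)
  moreover have "g t \<le> g 0 + t * d + q * C \<or> g t \<le> g 0 + t * d + (1 - q) * C"
  proof (cases "t \<le> p")
    case True
    have x: "t / p \<in> {0..1}"
      using True t pq by auto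
    have "g t \<le> q * g (t / p) + (1 - q) * g 0"
      using two[OF x, of 0] pq by simp
    also have "\<dots> \<le> q * (C + g 0 + t / p * d) + (1 - q) * g 0"
      using C'[OF x] pq by simp
    also have "\<dots> = g 0 + q * C + q / p * (t * d)"
      by (simp add: algebra_simps)
    also have "\<dots> \<le> g 0 + q * C + 1 * (t * d)"
      using pq t d by (intro add_left_mono mult_right_mono) auto
    finally show ?thesis by simp
  next
    case False
    define y where "y = (t - p) / (1 - p)"
    have y: "y \<in> {0..1}"
      using False t pq by (auto simp: y_def field_simps)
    have ty: "t = p + (1 - p) * y"
      using pq by (simp add: y_def)
    have "g t \<le> q * g 1 + (1 - q) * g y"
      using two[of 1 y] y ty by simp
    also have "\<dots> \<le> q * g 1 + (1 - q) * (C + g 0 + y * d)"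
      using C'[OF y] pq by simp
    also have "\<dots> = g 0 + (1 - q) * C + (y + q * (1 - y)) * d"
      by (simp add: d algebra_simps)
    also have "\<dots> \<le> g 0 + (1 - q) * C + (y + p * (1 - y)) * d"
      using pq y d by (intro add_left_mono mult_right_mono) auto
    also have "y + p * (1 - y) = t"
      by (simp add: ty algebra_simps)
    finally show ?thesis by simp
  qed
  ultimately show ?thesis
    unfolding chord by linarith
qed

text \<open>Since \<open>g \<le> g 1\<close> and the chord is at least \<open>g 0\<close>, the
  excess is at most \<open>K = g 1 - g 0\<close>. Iterating the contraction improves this to
  \<open>\<rho> ^ n * K\<close>, which tends to 0.\<close>

lemma below_chord_if_increasing:
  fixes g :: "real \<Rightarrow> real"
  assumes pq: "0 < p" "p < 1" "0 < q" "q < 1"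
    and two: "\<And>x y. x \<in> {0..1} \<Longrightarrow> y \<in> {0..1} \<Longrightarrow>
      g (p * x + (1 - p) * y) \<le> q * g x + (1 - q) * g y"
    and mono: "g 0 \<le> g 1"
    and bound: "\<And>t. t \<in> {0..1} \<Longrightarrow> g t \<le> g 1"
    and t: "t \<in> {0..1}"
  shows "g t \<le> (1 - t) * g 0 + t * g 1"
proof -
  define \<rho> where "\<rho> = max q (1 - q)"
  define K where "K = g 1 - g 0"
  have \<rho>: "0 < \<rho>" "\<rho> < 1"
    using pq by (auto simp: \<rho>_def)
  have K: "0 \<le> K"
    using mono by (simp add: K_def)
  have excess: "g s - ((1 - s) * g 0 + s * g 1) \<le> \<rho> ^ n * K" if "s \<in> {0..1}" for n s
    using that
  proof (induction n arbitrary: s)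
    case 0
    have "g 0 \<le> (1 - s) * g 0 + s * g 1"
      using mult_left_mono[OF mono, of s] 0 by (simp add: algebra_simps)
    then show ?case
      using bound[OF 0] by (simp add: K_def)
  next
    case (Suc n)
    have nonneg: "0 \<le> \<rho> ^ n * K"
      using \<rho> K by simp
    show ?case
    proof (cases "q \<le> p")
      case True
      show ?thesis
        using chord_excess_contraction[OF pq(1-3) True two mono nonneg Suc.IH Suc.prems]
        by (simp add: \<rho>_def mult.assoc)
    next
      case False
      \<comment> \<open>Exchanging \<open>x\<close> and \<open>y\<close> replaces \<open>p\<close>,
        \<open>q\<close> by \<open>1 - p\<close>, \<open>1 - q\<close>, which reverses the order of
        the two weights.\<close>
      have "g ((1 - p) * x + (1 - (1 - p)) * y) \<le> (1 - q) * g x + (1 - (1 - q)) * g y"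
        if "x \<in> {0..1}" "y \<in> {0..1}" for x y
        using two[OF that(2,1)] by (simp add: algebra_simps)
      then show ?thesis
        using chord_excess_contraction[OF _ _ _ _ _ mono nonneg Suc.IH Suc.prems,
            where p = "1 - p" and q = "1 - q"] pq False
        by (simp add: \<rho>_def mult.assoc max.commute)
    qed
  qed
  have "(\<lambda>n. \<rho> ^ n * K) \<longlonglongrightarrow> 0"
    using \<rho> by (intro tendsto_mult_left_zero LIMSEQ_power_zero) auto
  then have "g t - ((1 - t) * g 0 + t * g 1) \<le> 0"
    by (rule LIMSEQ_le_const) (use excess[OF t] in auto)
  then show ?thesis by simp
qed

text \<open>Reflecting \<open>[0,1]\<close> by \<open>1 - s\<close> reduces the case
  \<open>g 1 < g 0\<close> to the increasing one, with the same \<open>p\<close> and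
  \<open>q\<close>.\<close>

lemma below_chord:
  fixes g :: "real \<Rightarrow> real"
  assumes pq: "0 < p" "p < 1" "0 < q" "q < 1"
    and two: "\<And>x y. x \<in> {0..1} \<Longrightarrow> y \<in> {0..1} \<Longrightarrow>
      g (p * x + (1 - p) * y) \<le> q * g x + (1 - q) * g y"
    and bound: "\<And>t. t \<in> {0..1} \<Longrightarrow> g t \<le> max (g 0) (g 1)"
    and t: "t \<in> {0..1}"
  shows "g t \<le> (1 - t) * g 0 + t * g 1"
proof (cases "g 0 \<le> g 1")
  case True
  then show ?thesis
    using below_chord_if_increasing[OF pq two True _ t] bound by simp
next
  case False
  have "g (1 - (p * x + (1 - p) * y)) \<le> q * g (1 - x) + (1 - q) * g (1 - y)"
    if "x \<in> {0..1}" "y \<in> {0..1}" for x y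
    using two[of "1 - x" "1 - y"] that by (simp add: algebra_simps)
  moreover have "g (1 - s) \<le> g (1 - 1)" if "s \<in> {0..1}" for s
    using bound[of "1 - s"] that False by simp
  ultimately show ?thesis
    using below_chord_if_increasing[OF pq, of "\<lambda>s. g (1 - s)" "1 - t"] False t
    by (simp add: algebra_simps)
qed

section \<open>From the sequence inequality to convexity\<close>

text \<open>The bound \<open>K\<close> in the premise, together with \<open>c\<close>, restricts it
  to sequences whose right-hand series converges, so that the argument can use real series.\<close>

lemma below_chord_if_sequence_inequality:
  fixes l m :: "nat \<Rightarrow> real" and g :: "real \<Rightarrow> real"
  assumes l: "\<And>i. l i > 0" "l sums 1" and m: "\<And>i. m i > 0" "m sums 1"
    and below: "\<And>t. t \<in> {0..1} \<Longrightarrow> c \<le> g t"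
    and ineq: "\<And>x K. (\<And>i. x i \<in> {0..1}) \<Longrightarrow> (\<And>i. g (x i) \<le> K) \<Longrightarrow>
      g (\<Sum>i. l i * x i) \<le> (\<Sum>i. m i * g (x i))"
    and t: "t \<in> {0..1}"
  shows "g t \<le> (1 - t) * g 0 + t * g 1"
proof -
  define p where "p = l 0 / (l 0 + l 1)"
  define q where "q = m 0 / (m 0 + m 1)"
  define M where "M = max (g 0) (g 1)"
  define A where "A = {t \<in> {0..1}. g t \<le> M}"
  have pq: "0 < p" "p < 1" "0 < q" "q < 1"
    using l(1)[of 0] l(1)[of 1] m(1)[of 0] m(1)[of 1] by (auto simp: p_def q_def field_simps)
  have two: "g (p * x + (1 - p) * y) \<le> q * g x + (1 - q) * g y"
    if "x \<in> {0..1}" "y \<in> {0..1}" for x y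
    unfolding p_def q_def by (rule two_point_inequality[OF l m _ that]) (rule ineq)
  have A01: "0 \<in> A" "1 \<in> A"
    by (auto simp: A_def M_def)
  have A_comb: "p * x + (1 - p) * y \<in> A" if "x \<in> A" "y \<in> A" for x y
  proof -
    have "p * x + (1 - p) * y \<in> {0..1}"
      using convexD[of "{0..1::real}" x y p "1 - p"] that pq by (auto simp: A_def)
    moreover have "q * g x + (1 - q) * g y \<le> M"
      using that pq by (intro convex_bound_le) (auto simp: A_def)
    then have "g (p * x + (1 - p) * y) \<le> M"
      using two[of x y] that by (auto simp: A_def)
    ultimately show ?thesis
      by (simp add: A_def)
  qed
  have "g s \<le> M" if s: "s \<in> {0..1}" for s
  proof -
    have dense: "\<exists>x\<in>A. a \<le> x \<and> x \<le> b" if "0 \<le> a" "a < b" "b \<le> 1" for a b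
      using dense_if_closed_under_fixed_combination[OF A01 pq(1,2) A_comb that] by blast
    \<comment> \<open>Writing \<open>s\<close> as an \<open>l\<close>-combination of points of
      \<open>A\<close> lets the sequence inequality carry the bound \<open>M\<close> over to
      \<open>s\<close>.\<close>
    obtain x where x: "\<And>i. x i \<in> A" and xs: "(\<lambda>i. l i * x i) sums s"
      using sums_with_coefficients_in_dense_set[OF l A01 dense, of s] s by auto
    have "g s = g (\<Sum>i. l i * x i)"
      using sums_unique[OF xs] by simp
    also have "\<dots> \<le> (\<Sum>i. m i * g (x i))"
      using x by (intro ineq) (auto simp: A_def)
    also have "\<dots> \<le> (\<Sum>i. m i * M)"
    proof (rule suminf_le)
      show "m i * g (x i) \<le> m i * M" for i
        using x[of i] m(1)[of i] by (simp add: A_def)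
      \<comment> \<open>The lower bound \<open>c\<close> enters here: with \<open>M\<close> it makes
        the values bounded, so the series converges and can be compared termwise.\<close>
      have "\<bar>g (x i)\<bar> \<le> max \<bar>c\<bar> \<bar>M\<bar>" for i
        using x[of i] below[of "x i"] by (auto simp: A_def)
      then show "summable (\<lambda>i. m i * g (x i))"
        using m by (intro summable_mult_bounded) (auto simp: sums_iff)
      show "summable (\<lambda>i. m i * M)"
        using m by (intro summable_mult2) (auto simp: sums_iff)
    qed
    also have "\<dots> = M"
      using sums_unique[OF sums_mult2[OF m(2), of M]] by simp
    finally show ?thesis .
  qed
  then show ?thesis
    using below_chord[OF pq two _ t] by (simp add: M_def)
qed

theorem theorem3p2:
  fixes lam mu :: "nat \<Rightarrow> real"
    and D :: "(real ^ 'd) set"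
    and f :: "real ^ 'd \<Rightarrow> real"
  assumes "lam \<in> Lambda" and "mu \<in> Lambda"
    and "D \<noteq> {}" and "convex D"
    and "bdd_below (f ` D)"
    and "\<And>x :: nat \<Rightarrow> real ^ 'd. bounded (range x) \<Longrightarrow> (\<And>i. x i \<in> D) \<Longrightarrow>
           ereal (f (\<Sum>i. lam i *\<^sub>R x i)) \<le> (\<Sum>i. ereal (mu i * f (x i)))"
  shows "convex_on D f"
proof (rule convex_onI)
  fix t :: real and x y
  assume t: "0 < t" "t < 1" and xy: "x \<in> D" "y \<in> D"
  define \<phi> where "\<phi> s = (1 - s) *\<^sub>R x + s *\<^sub>R y" for s :: real
  note l = Lambda_pos[OF assms(1)] Lambda_sums[OF assms(1)]
  note m = Lambda_pos[OF assms(2)] Lambda_sums[OF assms(2)]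
  obtain c where c: "\<And>z. z \<in> D \<Longrightarrow> c \<le> f z"
    using assms(5) by (auto simp: bdd_below_def)
  have \<phi>_D: "\<phi> s \<in> D" if "s \<in> {0..1}" for s
    unfolding \<phi>_def using assms(4) xy that by (intro convexD) auto
  have "f (\<phi> t) \<le> (1 - t) * f (\<phi> 0) + t * f (\<phi> 1)"
  proof (rule below_chord_if_sequence_inequality[OF l m, where c = c])
    show "c \<le> f (\<phi> s)" if "s \<in> {0..1}" for s
      using c \<phi>_D that by blast
    fix u :: "nat \<Rightarrow> real" and K
    assume u: "\<And>i. u i \<in> {0..1}" and K: "\<And>i. f (\<phi> (u i)) \<le> K"
    have "bounded (range (\<lambda>i. \<phi> (u i)))"
    proof (rule bounded_subset)
      show "bounded (closed_segment x y)"
        by (rule bounded_closed_segment)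
      show "range (\<lambda>i. \<phi> (u i)) \<subseteq> closed_segment x y"
        using u by (auto simp: closed_segment_def \<phi>_def)
    qed
    then have le: "ereal (f (\<Sum>i. lam i *\<^sub>R \<phi> (u i))) \<le> (\<Sum>i. ereal (mu i * f (\<phi> (u i))))"
      using assms(6) \<phi>_D u by blast
    have "summable (\<lambda>i. lam i * u i)"
      using u l by (intro summable_mult_bounded[where K = 1]) (auto simp: sums_iff)
    \<comment> \<open>As \<open>lam\<close> sums to 1 and \<open>\<phi>\<close> is affine,
      \<open>\<phi>\<close> commutes with the infinite combination.\<close>
    then have "(\<lambda>i. lam i *\<^sub>R x + (lam i * u i) *\<^sub>R (y - x)) sums
        (1 *\<^sub>R x + (\<Sum>i. lam i * u i) *\<^sub>R (y - x))"
      using l(2) by (intro sums_add sums_scaleR_left) auto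
    moreover have "lam i *\<^sub>R x + (lam i * u i) *\<^sub>R (y - x) = lam i *\<^sub>R \<phi> (u i)" for i
      by (simp add: \<phi>_def algebra_simps)
    moreover have "1 *\<^sub>R x + (\<Sum>i. lam i * u i) *\<^sub>R (y - x) = \<phi> (\<Sum>i. lam i * u i)"
      by (simp add: \<phi>_def algebra_simps)
    ultimately have lhs: "(\<Sum>i. lam i *\<^sub>R \<phi> (u i)) = \<phi> (\<Sum>i. lam i * u i)"
      by (simp add: sums_iff)
    \<comment> \<open>Bounded values make the real series converge, so the sum in the extended reals
      is this real number.\<close>
    have "\<bar>f (\<phi> (u i))\<bar> \<le> max \<bar>c\<bar> \<bar>K\<bar>" for i
      using c[OF \<phi>_D[OF u[of i]]] K[of i] by auto
    then have "summable (\<lambda>i. mu i * f (\<phi> (u i)))"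
      using m by (intro summable_mult_bounded) (auto simp: sums_iff)
    then have "(\<Sum>i. ereal (mu i * f (\<phi> (u i)))) = ereal (\<Sum>i. mu i * f (\<phi> (u i)))"
      by (simp add: sums_ereal sums_unique[symmetric] summable_sums)
    then show "f (\<phi> (\<Sum>i. lam i * u i)) \<le> (\<Sum>i. mu i * f (\<phi> (u i)))"
      using le by (simp add: lhs)
  qed (use t in auto)
  then show "f ((1 - t) *\<^sub>R x + t *\<^sub>R y) \<le> (1 - t) * f x + t * f y"
    by (simp add: \<phi>_def)
qed (fact assms(4))

end
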